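(* Consider a GEE method (general linear method with global error estimation) of order $p$ with $r=2$ values, coefficients $(\mathbf A,\mathbf U,\mathbf B,\mathbf V)$ and $\mathbf V=I_2$, as defined in the context. If the off-diagonal elements of the $2\times2$ matrix $\mathbf B\mathbf U$ are zero, then the method satisfies the following output independence property: for each $\ell\in\{1,2\}$ and every rooted tree $\tau_j$ with $\rho(\tau_j)\in\{p+1,p+2\}$, the output weight $\widehat\xi_\ell(\tau_j)$, as a function of the input weights $\xi_1(\tau),\xi_2(\tau)$, depends on the input weights of trees $\tau_k$ with $\rho(\tau_k)\in\{p+1,p+2\}$ only through those of the same component $\ell$; that is, $$\widehat\xi_{\ell}(\tau_j)\big(\xi_1(\tau_k),\xi_2(\tau_k),\xi_{\{1,2\}}(\tau_q)\big)=\widehat\xi_{\ell}(\tau_j)\big(\xi_\ell(\tau_k),\xi_{\{1,2\}}(\tau_q)\big)$$ for all $\tau_j,\tau_k$ with $\rho(\tau_j),\rho(\tau_k)\in\{p+1,p+2\}$ and $\rho(\tau_q)\in\{1,\dots,p\}$.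
   Context: A two-value ($r=2$) $s$-stage general linear method applied to $y'=f(y)$ is $$Y_{(i)}=\Delta t\sum_{j=1}^s\mathbf A_{ij}f(Y_{(j)})+\sum_{j=1}^2\mathbf U_{ij}y_{(j)}^{[n-1]}\ (1\le i\le s),\qquad y_{(i)}^{[n]}=\Delta t\sum_{j=1}^s\mathbf B_{ij}f(Y_{(j)})+\sum_{j=1}^2\mathbf V_{ij}y_{(j)}^{[n-1]}\ (i=1,2),$$ where the two propagated quantities are two numerical solutions $y_{(1)}=y$, $y_{(2)}=\tilde y$ of the ODE. In the paper $\mathbf V=I_2$. Algebraic representation: rooted trees are generated from $\bullet$ (order 1) by $\tau=[\tau_1,\dots,\tau_k]$ (attach the roots of $\tau_1,\dots,\tau_k$ to a new root); $\rho(\tau)$ is the number of vertices and $\emptyset$ is the empty tree. The input is represented by $\xi(\tau)=[\xi_1(\tau),\xi_2(\tau)]^T$ with $\xi_1(\emptyset)=\xi_2(\emptyset)=1$. The mappings $\eta,\eta D$ (stages and stage derivatives, values in $\mathbb R^s$) and $\widehat\xi$ (output, values in $\mathbb R^2$) are determined by $$\eta(\tau)=\mathbf A\,\eta D(\tau)+\mathbf U\,\xi(\tau),\qquad \widehat\xi(\tau)=\mathbf B\,\eta D(\tau)+\mathbf V\,\xi(\tau),$$ with $\eta D(\emptyset)=0$, $\eta D(\bullet)=\mathbf 1$, and $\eta D([\tau_1,\dots,\tau_k])=\eta(\tau_1)\cdots\eta(\tau_k)$ (componentwise product). The method is preconsistent: $\mathbf U[1,1]^T=\mathbf 1$. GEE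 method of order $p$: let $\tau!$ be the tree factorial ($\bullet!=1$, $[\tau_1,\dots,\tau_k]!=\rho([\tau_1,\dots,\tau_k])\,\tau_1!\cdots\tau_k!$), so the elementary weights of the exact solution after one step are $1/\tau!$. When the input is exact ($\xi_1(\tau)=\xi_2(\tau)=0$ for all nonempty $\tau$) the outputs satisfy $\widehat\xi_1(\tau)=\widehat\xi_2(\tau)=1/\tau!$ for $1\le\rho(\tau)\le p$, and there is a constant $\gamma\ne1$ with $\gamma\big(1/\tau!-\widehat\xi_1(\tau)\big)=1/\tau!-\widehat\xi_2(\tau)$ for all $\tau$ with $\rho(\tau)=p+1$. In the independence property the input weights $\xi_1(\tau),\xi_2(\tau)$, for nonempty $\tau$, are regarded as free variables. *)

theory Defs
  imports "HOL-Analysis.Analysis" "HOL-Library.Multiset"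
begin

text \<open>
  Nonempty unordered rooted trees: \<open>Node {#t1, ..., tk#}\<close> is \<open>[t1, ..., tk]\<close>, and
  \<open>Node {#}\<close> is the one-vertex tree. Weights that are also defined on the empty tree have
  domain \<open>rtree option\<close>, where \<open>None\<close> is the empty tree.
\<close>

datatype rtree = Node "rtree multiset"

primrec tree_order :: "rtree \<Rightarrow> nat" where
  "tree_order (Node ts) = Suc (\<Sum>\<^sub># (image_mset tree_order ts))"

primrec tree_fact :: "rtree \<Rightarrow> nat" where
  "tree_fact (Node ts) = tree_order (Node ts) * (\<Prod>\<^sub># (image_mset tree_fact ts))"

text \<open>
  An \<open>s\<close>-stage method with two propagated values is given by its coefficient matrices
  \<open>A\<close> (\<open>s \<times> s\<close>), \<open>U\<close> (\<open>s \<times> 2\<close>), \<open>B\<close> (\<open>2 \<times> s\<close>) and \<open>V\<close> (\<open>2 \<times> 2\<close>); the stages are indexed by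
  the finite type \<open>'s\<close>. The next recursion has the stage weight \<open>\<eta>\<close> inlined; the
  equations for \<open>\<eta>\<close> and \<open>\<eta>D\<close> in their mutually recursive form are recovered in
  \<open>stage_weight_eq\<close> and \<open>stage_deriv_weight_simps\<close> below.
\<close>

primrec stage_deriv_tree ::
  "real^'s^'s \<Rightarrow> real^2^'s \<Rightarrow> (rtree option \<Rightarrow> real^2) \<Rightarrow> rtree \<Rightarrow> real^'s::finite" where
  "stage_deriv_tree A U \<xi> (Node ts) =
     (\<chi> i. \<Prod>\<^sub># (image_mset (\<lambda>t. (A *v stage_deriv_tree A U \<xi> t + U *v \<xi> (Some t)) $ i) ts))"

definition stage_deriv_weight ::
  "real^'s^'s \<Rightarrow> real^2^'s \<Rightarrow> (rtree option \<Rightarrow> real^2) \<Rightarrow> rtree option \<Rightarrow> real^'s::finite" where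
  "stage_deriv_weight A U \<xi> \<tau> = (case \<tau> of None \<Rightarrow> 0 | Some t \<Rightarrow> stage_deriv_tree A U \<xi> t)"

definition stage_weight ::
  "real^'s^'s \<Rightarrow> real^2^'s \<Rightarrow> (rtree option \<Rightarrow> real^2) \<Rightarrow> rtree option \<Rightarrow> real^'s::finite" where
  stage_weight_eq: "stage_weight A U \<xi> \<tau> = A *v stage_deriv_weight A U \<xi> \<tau> + U *v \<xi> \<tau>"

lemma stage_deriv_weight_simps:
  shows "stage_deriv_weight A U \<xi> None = 0"
    and "stage_deriv_weight A U \<xi> (Some (Node {#})) = vec 1"
    and "stage_deriv_weight A U \<xi> (Some (Node ts)) =
           (\<chi> i. \<Prod>t\<in>#ts. stage_weight A U \<xi> (Some t) $ i)"
  by (simp_all add: stage_deriv_weight_def stage_weight_eq vec_eq_iff)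

definition output_weight ::
  "real^'s^'s \<Rightarrow> real^2^'s \<Rightarrow> real^'s^2 \<Rightarrow> real^2^2 \<Rightarrow>
     (rtree option \<Rightarrow> real^2) \<Rightarrow> rtree option \<Rightarrow> real^2" where
  "output_weight A U B V \<xi> \<tau> = B *v stage_deriv_weight A U \<xi> \<tau> + V *v \<xi> \<tau>"

definition input_weights :: "(rtree option \<Rightarrow> real^2) \<Rightarrow> bool" where
  "input_weights \<xi> \<longleftrightarrow> \<xi> None $ 1 = 1 \<and> \<xi> None $ 2 = 1"

definition exact_input :: "rtree option \<Rightarrow> real^2" where
  "exact_input \<tau> = (case \<tau> of None \<Rightarrow> vec 1 | Some t \<Rightarrow> 0)"

definition preconsistent :: "real^2^'s \<Rightarrow> bool" where
  "preconsistent U \<longleftrightarrow> U *v vec 1 = vec 1"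

definition gee_method ::
  "nat \<Rightarrow> real^'s^'s \<Rightarrow> real^2^'s \<Rightarrow> real^'s^2 \<Rightarrow> real^2^2 \<Rightarrow> bool" where
  "gee_method p A U B V \<longleftrightarrow>
     preconsistent U \<and>
     (\<forall>t. 1 \<le> tree_order t \<and> tree_order t \<le> p \<longrightarrow>
        output_weight A U B V exact_input (Some t) $ 1 = 1 / real (tree_fact t) \<and>
        output_weight A U B V exact_input (Some t) $ 2 = 1 / real (tree_fact t)) \<and>
     (\<exists>\<gamma>::real. \<gamma> \<noteq> 1 \<and>
        (\<forall>t. tree_order t = p + 1 \<longrightarrow>
           \<gamma> * (1 / real (tree_fact t) - output_weight A U B V exact_input (Some t) $ 1) =
           1 / real (tree_fact t) - output_weight A U B V exact_input (Some t) $ 2))"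

text \<open>
  The component \<open>l\<close> of the output weight of a tree of order \<open>p + 1\<close> or \<open>p + 2\<close> is a function of
  the component-\<open>l\<close> input weights of trees of these two orders and of all input weights of
  trees of order \<open>1, ..., p\<close>: any two inputs that agree on these produce the same value.
  All other input weights of nonempty trees, including those of order above \<open>p + 2\<close>, are
  unconstrained.
\<close>

definition output_independent ::
  "nat \<Rightarrow> real^'s^'s \<Rightarrow> real^2^'s \<Rightarrow> real^'s^2 \<Rightarrow> real^2^2 \<Rightarrow> bool" where
  "output_independent p A U B V \<longleftrightarrow>
     (\<forall>l::2. \<forall>tj. tree_order tj \<in> {p + 1, p + 2} \<longrightarrow>
        (\<forall>\<xi> \<xi>'. input_weights \<xi> \<longrightarrow> input_weights \<xi>' \<longrightarrow>
           (\<forall>tk. tree_order tk \<in> {p + 1, p + 2} \<longrightarrow> \<xi> (Some tk) $ l = \<xi>' (Some tk) $ l) \<longrightarrow>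
           (\<forall>tq. tree_order tq \<in> {1..p} \<longrightarrow>
              \<xi> (Some tq) $ 1 = \<xi>' (Some tq) $ 1 \<and> \<xi> (Some tq) $ 2 = \<xi>' (Some tq) $ 2) \<longrightarrow>
           output_weight A U B V \<xi> (Some tj) $ l = output_weight A U B V \<xi>' (Some tj) $ l))"

end

theory Submission
  imports Defs
begin

text \<open>
  Stage derivative weights of \<open>\<tau>\<close> involve only input weights of trees smaller than \<open>\<tau>\<close>.
  So an input weight of order above \<open>p\<close> enters the output weight of a tree of order \<open>\<le> p + 2\<close>
  either through \<open>V = I\<close>, or, for \<open>[\<tau>']\<close> with \<open>\<tau>'\<close> of order \<open>p + 1\<close>, linearly as
  \<open>B U \<xi>(\<tau>')\<close>; both maps are diagonal.
\<close>

lemma tree_order_less_Node: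
  assumes "t \<in># ts"
  shows "tree_order t < tree_order (Node ts)"
proof -
  from assms obtain rs where "ts = add_mset t rs"
    by (metis mset_add)
  then show ?thesis by simp
qed

lemma tree_order_pos: "tree_order t > 0"
  by (cases t) simp

lemma stage_deriv_tree_Node_cong:
  assumes "\<And>t. t \<in># ts \<Longrightarrow> stage_deriv_tree A U \<xi> t = stage_deriv_tree A U \<xi>' t"
    and "\<And>t. t \<in># ts \<Longrightarrow> \<xi> (Some t) = \<xi>' (Some t)"
  shows "stage_deriv_tree A U \<xi> (Node ts) = stage_deriv_tree A U \<xi>' (Node ts)"
proof -
  have "(A *v stage_deriv_tree A U \<xi> t + U *v \<xi> (Some t)) $ i =
      (A *v stage_deriv_tree A U \<xi>' t + U *v \<xi>' (Some t)) $ i" if "t \<in># ts" for t i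
    using assms [OF that] by simp
  then show ?thesis
    by (simp add: vec_eq_iff del: vector_add_component cong: image_mset_cong)
qed

text \<open>The stage derivative of a tree is built from the stage weights of its children, so its
  own input weight never enters. This is why the bound is strict, and it passes to subtrees in the
  induction.\<close>

lemma stage_deriv_tree_cong:
  assumes "\<And>r. tree_order r < tree_order t \<Longrightarrow> \<xi> (Some r) = \<xi>' (Some r)"
  shows "stage_deriv_tree A U \<xi> t = stage_deriv_tree A U \<xi>' t"
  using assms
proof (induction t)
  case (Node ts)
  show ?case
  proof (rule stage_deriv_tree_Node_cong)
    fix t assume "t \<in># ts"
    then have less: "tree_order t < tree_order (Node ts)"
      by (rule tree_order_less_Node)
    show "\<xi> (Some t) = \<xi>' (Some t)"
      using Node.prems less .
    show "stage_deriv_tree A U \<xi> t = stage_deriv_tree A U \<xi>' t"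
      by (rule Node.IH [OF \<open>t \<in># ts\<close>]) (use Node.prems less in \<open>blast intro: less_trans\<close>)
  qed
qed

text \<open>A child with just one vertex less than the whole tree uses up everything but the root. A
  sibling would need at least one more vertex, so there is none.\<close>

lemma Node_child_order_cases:
  obtains (small) "\<And>t. t \<in># ts \<Longrightarrow> tree_order t + 1 < tree_order (Node ts)"
    | (single) t where "ts = {#t#}"
proof (cases "\<exists>t \<in># ts. \<not> tree_order t + 1 < tree_order (Node ts)")
  case True
  then obtain t rs where t: "ts = add_mset t rs" "\<not> tree_order t + 1 < tree_order (Node ts)"
    by (metis mset_add)
  have "rs = {#}"
  proof (rule ccontr)
    assume "rs \<noteq> {#}"
    then obtain r rs' where "rs = add_mset r rs'"
      by (metis multiset_cases)
    with t tree_order_pos [of r] show False by simp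
  qed
  with t single show ?thesis by simp
qed (use small in blast)

text \<open>The product over the children has one factor, so \<open>\<xi> (Some t)\<close> enters
  linearly and can be multiplied by \<open>B\<close>.\<close>

lemma stage_deriv_tree_single:
  "stage_deriv_tree A U \<xi> (Node {#t#}) = A *v stage_deriv_tree A U \<xi> t + U *v \<xi> (Some t)"
  by (simp add: vec_eq_iff)

lemma output_weight_Some_mat_1:
  "output_weight A U B (mat 1) \<xi> (Some t) = B *v stage_deriv_tree A U \<xi> t + \<xi> (Some t)"
  by (simp add: output_weight_def stage_deriv_weight_def)

lemma diagonal_matrix_vector_mult:
  fixes M :: "real^2^2"
  assumes "M $ 1 $ 2 = 0" and "M $ 2 $ 1 = 0"
  shows "(M *v x) $ l = M $ l $ l * x $ l"
  using exhaust_2 [of l] assms by (auto simp: matrix_vector_mult_def sum_2)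

theorem proposition4p3:
  fixes A :: "real^'s^'s" and U :: "real^2^'s" and B :: "real^'s^2" and V :: "real^2^2"
    and p :: nat
  assumes "gee_method p A U B V"
    and "V = mat 1"
    and "(B ** U) $ 1 $ 2 = 0" and "(B ** U) $ 2 $ 1 = 0"
  shows "output_independent p A U B V"
  unfolding output_independent_def
proof (intro allI impI)
  fix l :: 2 and tj and \<xi> \<xi>' :: "rtree option \<Rightarrow> real^2"
  assume tj: "tree_order tj \<in> {p + 1, p + 2}"
    and high: "\<forall>tk. tree_order tk \<in> {p + 1, p + 2} \<longrightarrow> \<xi> (Some tk) $ l = \<xi>' (Some tk) $ l"
    and low: "\<forall>tq. tree_order tq \<in> {1..p} \<longrightarrow>
              \<xi> (Some tq) $ 1 = \<xi>' (Some tq) $ 1 \<and> \<xi> (Some tq) $ 2 = \<xi>' (Some tq) $ 2"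
  have low_eq: "\<xi> (Some t) = \<xi>' (Some t)" if "tree_order t \<le> p" for t
    using low that tree_order_pos [of t] by (simp add: vec_eq_iff forall_2 Suc_le_eq)
  \<comment> \<open>Order p + 1 is still allowed, since only trees of order at most p
    contribute.\<close>
  have deriv_eq: "stage_deriv_tree A U \<xi> t = stage_deriv_tree A U \<xi>' t"
    if "tree_order t \<le> p + 1" for t
    by (rule stage_deriv_tree_cong) (use that low_eq in simp)
  have "(B *v stage_deriv_tree A U \<xi> tj) $ l = (B *v stage_deriv_tree A U \<xi>' tj) $ l"
  proof (cases tj)
    case (Node ts)
    show ?thesis
    proof (cases rule: Node_child_order_cases [of ts])
      case small
      then have "tree_order t \<le> p" if "t \<in># ts" for t
        using that tj Node by fastforce
      then have "stage_deriv_tree A U \<xi> tj = stage_deriv_tree A U \<xi>' tj"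
        unfolding Node by (intro stage_deriv_tree_Node_cong low_eq deriv_eq) (simp_all add: le_SucI)
      then show ?thesis by simp
    next
      case (single t)
      then have t: "tree_order t \<le> p + 1"
        using tj Node by auto
      \<comment> \<open>The child has order p or p + 1. In the second case only component
        \<open>l\<close> is known to agree.\<close>
      then have "\<xi> (Some t) $ l = \<xi>' (Some t) $ l"
        using high low_eq by (cases "tree_order t \<le> p") (auto simp: le_Suc_eq)
      \<comment> \<open>After distributing \<open>B\<close>, the input weight of the child appears
        as \<open>(B ** U) *v \<xi> (Some t)\<close>, whose component \<open>l\<close> reads only
        component \<open>l\<close> of the input.\<close>
      with deriv_eq [OF t] show ?thesis
        by (simp add: Node single stage_deriv_tree_single matrix_vector_right_distrib
            matrix_vector_mul_assoc diagonal_matrix_vector_mult [OF assms(3,4)]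
            del: stage_deriv_tree.simps)
    qed
  qed
  \<comment> \<open>What remains is the summand from \<open>V\<close>, the input weight of
    \<open>tj\<close> itself, whose component \<open>l\<close> agrees by
    \<open>high\<close>.\<close>
  then show "output_weight A U B V \<xi> (Some tj) $ l = output_weight A U B V \<xi>' (Some tj) $ l"
    using tj high by (auto simp: \<open>V = mat 1\<close> output_weight_Some_mat_1)
qed

end
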